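(* Consider $n$ agents in $\mathbb{R}^2$ with positions $p_1(t),\dots,p_n(t)$, $t\ge 0$, visibility range $V>0$, band width $0<\delta<V$ and gain $\sigma>0$, moving according to $$\dot p_i(t)=\begin{cases}\sigma\sum_{j\in N_i(t)}\bigl(p_j(t)-p_i(t)\bigr), & B_i(t)=\emptyset,\\[1ex] \sigma\bigl(U_i^-(t)+U_i^+(t)\bigr), & B_i(t)\ne\emptyset \text{ and } \psi_i(t)<\pi,\\[1ex] 0,&\text{otherwise,}\end{cases}$$ with $N_i,B_i,\psi_i,U_i^\pm$ as defined in the context. Then, for any initial constellation whose neighborhood graph is connected, the agents asymptotically gather to a point, i.e. there is a point $q\in\mathbb{R}^2$ with $\lim_{t\to\infty}p_i(t)=q$ for all $i$.
   Context: System $\mathcal{S}_5$ (finite visibility, relative position sensing, continuous time). Agent $j\neq i$ is a neighbour of agent $i$ at time $t$, $j\in N_i(t)$, iff $\|p_i(t)-p_j(t)\|<V$. The neighborhood graph at time $t$ has the agents as vertices and the pairs of neighbours as edges. $B_i(t)\subseteq N_i(t)$ is the set of neighbours of $i$ whose distance from $p_i(t)$ is between $V-\delta$ and $V$ (i.e. at least $V-\delta$), where $\delta$ is a small positive constant. $\psi_i(t)$ is the angular span of the minimal angular sector with apex $p_i(t)$ containing all agents of $B_i(t)$, and $U_i^-(t),U_i^+(t)$ are the unit vectors from $p_i(t)$ to the right and left extremal agents of $B_i(t)$ that define this minimal sector (if $B_i(t)$ has a single agent, $U_i^-(t)=U_i^+(t)$). *)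

theory Defs
  imports "HOL-Analysis.Analysis"
begin

section \<open>Angular sectors in the plane\<close>

definition unit_dir :: "real \<Rightarrow> real^2" where
  "unit_dir \<theta> = vector [cos \<theta>, sin \<theta>]"

text \<open>The closed sector with the given apex that extends counterclockwise from direction
  \<open>\<theta>\<close> (its right boundary ray) to direction \<open>\<theta> + \<phi>\<close> (its left boundary ray).\<close>

definition sector :: "real^2 \<Rightarrow> real \<Rightarrow> real \<Rightarrow> (real^2) set" where
  "sector a \<theta> \<phi> = {a + r *\<^sub>R unit_dir s | r s. 0 \<le> r \<and> \<theta> \<le> s \<and> s \<le> \<theta> + \<phi>}"

definition angular_span :: "real^2 \<Rightarrow> (real^2) set \<Rightarrow> real" where
  "angular_span a X = Inf {\<phi>. 0 \<le> \<phi> \<and> (\<exists>\<theta>. X \<subseteq> sector a \<theta> \<phi>)}"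

text \<open>The unit vectors from \<open>a\<close> to the points of \<open>X\<close> on the right and left boundary rays of the
  minimal sector containing \<open>X\<close>. They are meaningful for a finite nonempty \<open>X\<close> that does not
  contain \<open>a\<close> and has angular span less than \<open>\<pi>\<close>; the minimal sector is then unique.
  The vector \<open>sgn (x - a)\<close> is \<open>x - a\<close> scaled to norm 1.\<close>

definition right_extremal :: "real^2 \<Rightarrow> (real^2) set \<Rightarrow> real^2" where
  "right_extremal a X = (THE u. \<exists>\<theta>. X \<subseteq> sector a \<theta> (angular_span a X) \<and>
     (\<exists>x\<in>X. u = sgn (x - a) \<and> u = unit_dir \<theta>))"

definition left_extremal :: "real^2 \<Rightarrow> (real^2) set \<Rightarrow> real^2" where
  "left_extremal a X = (THE u. \<exists>\<theta>. X \<subseteq> sector a \<theta> (angular_span a X) \<and>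
     (\<exists>x\<in>X. u = sgn (x - a) \<and> u = unit_dir (\<theta> + angular_span a X)))"

section \<open>Neighbours and the velocity field\<close>

text \<open>A constellation \<open>x\<close> assigns a position to each agent; \<open>V\<close> is the visibility range,
  \<open>\<delta>\<close> the width of the band and \<open>\<sigma>\<close> the gain.\<close>

definition neighbours :: "real \<Rightarrow> ('n \<Rightarrow> real^2) \<Rightarrow> 'n \<Rightarrow> 'n set" where
  "neighbours V x i = {j. j \<noteq> i \<and> norm (x i - x j) < V}"

definition band_neighbours :: "real \<Rightarrow> real \<Rightarrow> ('n \<Rightarrow> real^2) \<Rightarrow> 'n \<Rightarrow> 'n set" where
  "band_neighbours V \<delta> x i = {j \<in> neighbours V x i. V - \<delta> \<le> norm (x i - x j)}"

definition neighbourhood_graph_connected :: "real \<Rightarrow> ('n \<Rightarrow> real^2) \<Rightarrow> bool" where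
  "neighbourhood_graph_connected V x \<longleftrightarrow> (\<forall>i j. (i, j) \<in> {(k, l). l \<in> neighbours V x k}\<^sup>*)"

definition velocity ::
  "real \<Rightarrow> real \<Rightarrow> real \<Rightarrow> ('n::finite \<Rightarrow> real^2) \<Rightarrow> 'n \<Rightarrow> real^2" where
  "velocity V \<delta> \<sigma> x i =
    (let B = x ` band_neighbours V \<delta> x i in
     if B = {} then \<sigma> *\<^sub>R (\<Sum>j\<in>neighbours V x i. x j - x i)
     else if angular_span (x i) B < pi
       then \<sigma> *\<^sub>R (right_extremal (x i) B + left_extremal (x i) B)
     else 0)"

section \<open>Trajectories\<close>

definition abs_continuous_on :: "real \<Rightarrow> real \<Rightarrow> (real \<Rightarrow> 'a::real_normed_vector) \<Rightarrow> bool" where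
  "abs_continuous_on a b f \<longleftrightarrow>
    (\<forall>e>0. \<exists>d>0. \<forall>D. D division_of \<Union>D \<longrightarrow> \<Union>D \<subseteq> {a..b} \<longrightarrow> (\<Sum>k\<in>D. Sup k - Inf k) < d \<longrightarrow>
       (\<Sum>k\<in>D. norm (f (Sup k) - f (Inf k))) < e)"

text \<open>The velocity field is discontinuous, so along a motion the velocity may jump and the
  derivative may fail to exist at the jumps. The differential equation is therefore read in the
  sense of Caratheodory: the trajectories are locally absolutely continuous and satisfy it at
  almost every time. Trajectories that satisfy it at every time are included, because the velocity
  is bounded.\<close>

definition moves_according_to ::
  "real \<Rightarrow> real \<Rightarrow> real \<Rightarrow> (real \<Rightarrow> 'n::finite \<Rightarrow> real^2) \<Rightarrow> bool" where
  "moves_according_to V \<delta> \<sigma> p \<longleftrightarrow>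
    (\<forall>i. (\<forall>T\<ge>0. abs_continuous_on 0 T (\<lambda>t. p t i)) \<and>
         (AE t in lebesgue. 0 \<le> t \<longrightarrow>
            ((\<lambda>s. p s i) has_vector_derivative velocity V \<delta> \<sigma> (p t) i) (at t within {0..})))"

end

theory Submission
  imports Defs
begin

text \<open>Two agents in each other's band never move apart, so neighbours stay neighbours and the initial
  edges persist. Fix a point \<open>z\<close>. The maximal squared distance \<open>m\<close> of an agent from \<open>z\<close> does not
  increase; call its infimum \<open>h\<close>. The deficits \<open>d\<^sub>i = m - |p\<^sub>i - z|\<^sup>2\<close> satisfy
  \<open>d\<^sub>i' \<ge> - C d\<^sub>i + \<sigma> min d\<^sub>k (2 (V - \<delta>))\<close> for every neighbour \<open>k\<close> of \<open>i\<close>, whichever rule agent \<open>i\<close> obeys. So a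
  deficit decays at most exponentially and spreads along the edges: if some agent has deficit \<open>A\<close>, then
  after a fixed time every agent has deficit at least some \<open>b > 0\<close> depending on \<open>A\<close> only. When \<open>m < h + b\<close>
  this contradicts the choice of \<open>h\<close>. Therefore all squared distances from \<open>z\<close> tend to \<open>h\<close>, and taking
  for \<open>z\<close> the origin and the unit vectors yields the limit of the positions by polarisation.\<close>

section \<open>Absolutely continuous functions\<close>

lemma abs_continuous_on_subinterval:
  assumes "abs_continuous_on a b f" "a \<le> c" "d \<le> b"
  shows "abs_continuous_on c d f"
  unfolding abs_continuous_on_def
proof (intro allI impI)
  fix e :: real assume "0 < e"
  with assms(1) obtain r where r: "0 < r" "\<And>D. D division_of \<Union>D \<Longrightarrow> \<Union>D \<subseteq> {a..b} \<Longrightarrow>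
     (\<Sum>k\<in>D. Sup k - Inf k) < r \<Longrightarrow> (\<Sum>k\<in>D. norm (f (Sup k) - f (Inf k))) < e"
    unfolding abs_continuous_on_def by meson
  have "{c..d} \<subseteq> {a..b}" using assms(2,3) by auto
  with r show "\<exists>r>0. \<forall>D. D division_of \<Union>D \<longrightarrow> \<Union>D \<subseteq> {c..d} \<longrightarrow> (\<Sum>k\<in>D. Sup k - Inf k) < r \<longrightarrow>
       (\<Sum>k\<in>D. norm (f (Sup k) - f (Inf k))) < e"
    by (intro exI[of _ r]) (auto dest: subset_trans[OF _ \<open>{c..d} \<subseteq> {a..b}\<close>])
qed

lemma division_member_real:
  fixes D :: "real set set"
  assumes "D division_of \<Union>D" "\<Union>D \<subseteq> {a..b}" "k \<in> D"
  shows "Inf k \<in> {a..b}" "Sup k \<in> {a..b}" "Inf k \<le> Sup k" "k = {Inf k..Sup k}"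
proof -
  obtain u v where k: "k = {u..v}" "k \<noteq> {}"
    using division_ofD(3,4)[OF assms(1,3)] by auto
  then have "u \<le> v" by auto
  moreover have "k \<subseteq> {a..b}" using assms by auto
  ultimately show "Inf k \<in> {a..b}" "Sup k \<in> {a..b}" "Inf k \<le> Sup k" "k = {Inf k..Sup k}"
    using k by auto
qed

text \<open>Over any division the increments of \<open>h\<close> sum to at most a constant times
  those of \<open>f\<close> and \<open>g\<close>. The closure properties below (differences, affine
  images, squared norms) are obtained from this one comparison.\<close>

lemma abs_continuous_on_dominated:
  fixes f :: "real \<Rightarrow> 'a::real_normed_vector" and g :: "real \<Rightarrow> 'b::real_normed_vector"
    and h :: "real \<Rightarrow> 'c::real_normed_vector"
  assumes f: "abs_continuous_on a b f" and g: "abs_continuous_on a b g"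
    and h: "\<And>u v. u \<in> {a..b} \<Longrightarrow> v \<in> {a..b} \<Longrightarrow>
      norm (h v - h u) \<le> K * (norm (f v - f u) + norm (g v - g u))"
  shows "abs_continuous_on a b h"
  unfolding abs_continuous_on_def
proof (intro allI impI)
  fix e :: real assume "0 < e"
  \<comment> \<open>\<open>K\<close> may be zero or negative; \<open>\<bar>K\<bar> + 1\<close> is a
    positive factor that dominates it.\<close>
  define e' where "e' = e / (2 * (\<bar>K\<bar> + 1))"
  have e': "0 < e'" unfolding e'_def using \<open>0 < e\<close> by simp
  obtain r where r: "0 < r" "\<And>D. D division_of \<Union>D \<Longrightarrow> \<Union>D \<subseteq> {a..b} \<Longrightarrow>
     (\<Sum>k\<in>D. Sup k - Inf k) < r \<Longrightarrow> (\<Sum>k\<in>D. norm (f (Sup k) - f (Inf k))) < e'"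
    using f e' unfolding abs_continuous_on_def by meson
  obtain s where s: "0 < s" "\<And>D. D division_of \<Union>D \<Longrightarrow> \<Union>D \<subseteq> {a..b} \<Longrightarrow>
     (\<Sum>k\<in>D. Sup k - Inf k) < s \<Longrightarrow> (\<Sum>k\<in>D. norm (g (Sup k) - g (Inf k))) < e'"
    using g e' unfolding abs_continuous_on_def by meson
  show "\<exists>d>0. \<forall>D. D division_of \<Union>D \<longrightarrow> \<Union>D \<subseteq> {a..b} \<longrightarrow> (\<Sum>k\<in>D. Sup k - Inf k) < d \<longrightarrow>
       (\<Sum>k\<in>D. norm (h (Sup k) - h (Inf k))) < e"
  proof (intro exI[of _ "min r s"] conjI allI impI)
    show "0 < min r s" using r s by simp
    fix D :: "real set set"
    assume D: "D division_of \<Union>D" "\<Union>D \<subseteq> {a..b}" "(\<Sum>k\<in>D. Sup k - Inf k) < min r s"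
    let ?F = "\<Sum>k\<in>D. norm (f (Sup k) - f (Inf k))" and ?G = "\<Sum>k\<in>D. norm (g (Sup k) - g (Inf k))"
    have "(\<Sum>k\<in>D. norm (h (Sup k) - h (Inf k))) \<le>
      (\<Sum>k\<in>D. (\<bar>K\<bar> + 1) * (norm (f (Sup k) - f (Inf k)) + norm (g (Sup k) - g (Inf k))))"
    proof (rule sum_mono)
      fix k assume "k \<in> D"
      then have "norm (h (Sup k) - h (Inf k)) \<le>
          K * (norm (f (Sup k) - f (Inf k)) + norm (g (Sup k) - g (Inf k)))"
        using division_member_real[OF D(1,2)] by (intro h) auto
      also have "\<dots> \<le> (\<bar>K\<bar> + 1) * (norm (f (Sup k) - f (Inf k)) + norm (g (Sup k) - g (Inf k)))"
        by (intro mult_right_mono) auto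
      finally show "norm (h (Sup k) - h (Inf k)) \<le>
          (\<bar>K\<bar> + 1) * (norm (f (Sup k) - f (Inf k)) + norm (g (Sup k) - g (Inf k)))" .
    qed
    also have "\<dots> = (\<bar>K\<bar> + 1) * (?F + ?G)"
      by (simp add: sum_distrib_left[symmetric] sum.distrib)
    also have "\<dots> < (\<bar>K\<bar> + 1) * (e' + e')"
      using r(2)[OF D(1,2)] s(2)[OF D(1,2)] D(3) by (intro mult_strict_left_mono add_strict_mono) auto
    also have "\<dots> = (2 * (\<bar>K\<bar> + 1)) * e'" by simp
    also have "\<dots> = e" unfolding e'_def using abs_ge_zero[of K] by simp
    finally show "(\<Sum>k\<in>D. norm (h (Sup k) - h (Inf k))) < e" .
  qed
qed

lemma abs_continuous_on_ident: "abs_continuous_on a b (\<lambda>t::real. t)"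
  unfolding abs_continuous_on_def
proof (intro allI impI)
  fix e :: real assume "0 < e"
  have "(\<Sum>k\<in>D. norm (Sup k - Inf k)) < e"
    if "D division_of \<Union>D" "\<Union>D \<subseteq> {a..b}" "(\<Sum>k\<in>D. Sup k - Inf k) < e" for D :: "real set set"
  proof -
    have "(\<Sum>k\<in>D. norm (Sup k - Inf k)) = (\<Sum>k\<in>D. Sup k - Inf k)"
      using division_member_real(3)[OF that(1,2)] by (intro sum.cong) auto
    then show ?thesis using that by simp
  qed
  then show "\<exists>d>0. \<forall>D. D division_of \<Union>D \<longrightarrow> \<Union>D \<subseteq> {a..b} \<longrightarrow> (\<Sum>k\<in>D. Sup k - Inf k) < d \<longrightarrow>
       (\<Sum>k\<in>D. norm (Sup k - Inf k)) < e"
    using \<open>0 < e\<close> by blast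
qed

lemma abs_continuous_on_imp_continuous_on:
  fixes f :: "real \<Rightarrow> 'a::real_normed_vector"
  assumes "abs_continuous_on a b f"
  shows "continuous_on {a..b} f"
  unfolding continuous_on_iff
proof (intro ballI allI impI)
  fix x e :: real assume x: "x \<in> {a..b}" and "0 < e"
  then obtain r where r: "0 < r" "\<And>D. D division_of \<Union>D \<Longrightarrow> \<Union>D \<subseteq> {a..b} \<Longrightarrow>
     (\<Sum>k\<in>D. Sup k - Inf k) < r \<Longrightarrow> (\<Sum>k\<in>D. norm (f (Sup k) - f (Inf k))) < e"
    using assms unfolding abs_continuous_on_def by meson
  have *: "norm (f v - f u) < e" if "u \<in> {a..b}" "v \<in> {a..b}" "u \<le> v" "v - u < r" for u v
  proof -
    have "{{u..v}} division_of \<Union>{{u..v}}"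
      using that division_of_self[of u v] by simp
    then show ?thesis using r(2)[of "{{u..v}}"] that by auto
  qed
  show "\<exists>d>0. \<forall>x'\<in>{a..b}. dist x' x < d \<longrightarrow> dist (f x') (f x) < e"
  proof (intro exI[of _ r] conjI ballI impI)
    fix y assume "y \<in> {a..b}" "dist y x < r"
    then show "dist (f y) (f x) < e"
      using *[of x y] *[of y x] x by (cases "x \<le> y") (auto simp: dist_norm norm_minus_commute)
  qed (fact r)
qed

lemma abs_continuous_on_diff:
  assumes "abs_continuous_on a b f" "abs_continuous_on a b g"
  shows "abs_continuous_on a b (\<lambda>t. f t - g t)"
proof (rule abs_continuous_on_dominated[OF assms])
  fix u v
  show "norm (f v - g v - (f u - g u)) \<le> 1 * (norm (f v - f u) + norm (g v - g u))"
    using norm_triangle_ineq4[of "f v - f u" "g v - g u"] by (simp add: algebra_simps)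
qed

lemma abs_continuous_on_affine:
  fixes f :: "real \<Rightarrow> real"
  assumes "abs_continuous_on a b f"
  shows "abs_continuous_on a b (\<lambda>t. c + k * f t)"
proof (rule abs_continuous_on_dominated[OF assms assms])
  fix u v
  have "(c + k * f v) - (c + k * f u) = k * (f v - f u)" by (simp add: algebra_simps)
  then have "norm ((c + k * f v) - (c + k * f u)) = \<bar>k\<bar> * norm (f v - f u)"
    by (simp only: real_norm_def abs_mult)
  also have "\<dots> \<le> \<bar>k\<bar> * (norm (f v - f u) + norm (f v - f u))"
    by (intro mult_left_mono) auto
  finally show "norm ((c + k * f v) - (c + k * f u)) \<le> \<bar>k\<bar> * (norm (f v - f u) + norm (f v - f u))" .
qed

text \<open>Continuity on a compact interval bounds the norm by some \<open>M\<close>, and a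
  difference of squares factors into a difference of norms and a sum of at most
  \<open>2 * M\<close>.\<close>

lemma abs_continuous_on_norm_square:
  fixes f :: "real \<Rightarrow> 'a::real_inner"
  assumes f: "abs_continuous_on a b f"
  shows "abs_continuous_on a b (\<lambda>t. (norm (f t))\<^sup>2)"
proof -
  have "compact (f ` {a..b})"
    using abs_continuous_on_imp_continuous_on[OF f] by (intro compact_continuous_image) auto
  then obtain M where M: "\<And>t. t \<in> {a..b} \<Longrightarrow> norm (f t) \<le> M"
    by (metis bounded_iff compact_imp_bounded imageI)
  show ?thesis
  proof (rule abs_continuous_on_dominated[OF f f])
    fix u v assume uv: "u \<in> {a..b}" "v \<in> {a..b}"
    have "norm ((norm (f v))\<^sup>2 - (norm (f u))\<^sup>2) = \<bar>norm (f v) - norm (f u)\<bar> * (norm (f v) + norm (f u))"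
      by (simp add: power2_eq_square square_diff_square_factored abs_mult)
    also have "\<dots> \<le> norm (f v - f u) * (M + M)"
      using M[OF uv(1)] M[OF uv(2)] norm_triangle_ineq3 by (intro mult_mono add_mono) auto
    finally show "norm ((norm (f v))\<^sup>2 - (norm (f u))\<^sup>2) \<le> M * (norm (f v - f u) + norm (f v - f u))"
      by (simp add: algebra_simps)
  qed
qed

text \<open>Take a fine tagged division. Intervals with a tag outside \<open>N\<close> increase \<open>f\<close> by at most \<open>e\<close> times
  their length; those with a tag in \<open>N\<close> lie in an open set of small measure, where absolute
  continuity applies.\<close>

lemma abs_continuous_nonincreasing:
  fixes f :: "real \<Rightarrow> real"
  assumes ac: "abs_continuous_on a b f" and ab: "a \<le> b" and N: "negligible N"
    and der: "\<And>t. t \<in> {a<..<b} \<Longrightarrow> t \<notin> N \<Longrightarrow> \<exists>D\<le>0. (f has_real_derivative D) (at t)"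
  shows "f b \<le> f a"
proof (rule ccontr)
  assume "\<not> f b \<le> f a"
  \<comment> \<open>The supposed increase is shared out: intervals with good tags account for at
    most \<open>e * (b - a)\<close> and those with bad tags for less than \<open>e\<close>, which
    together falls short of \<open>f b - f a\<close>.\<close>
  define e where "e = (f b - f a) / (b - a + 1)"
  have e: "0 < e" "e * (b - a) + e = f b - f a"
  proof -
    show "0 < e" using \<open>\<not> f b \<le> f a\<close> ab by (simp add: e_def)
    have "e * (b - a + 1) = f b - f a" using ab by (simp add: e_def)
    then show "e * (b - a) + e = f b - f a" by (simp add: algebra_simps)
  qed
  obtain d where d: "0 < d" "\<And>D. D division_of \<Union>D \<Longrightarrow> \<Union>D \<subseteq> {a..b} \<Longrightarrow>
     (\<Sum>k\<in>D. Sup k - Inf k) < d \<Longrightarrow> (\<Sum>k\<in>D. norm (f (Sup k) - f (Inf k))) < e"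
    using ac e(1) unfolding abs_continuous_on_def by meson
  \<comment> \<open>The derivative is controlled in the open interval only, so the endpoints join
    the exceptional set.\<close>
  define N' where "N' = N \<union> {a, b}"
  have N': "negligible N'" unfolding N'_def using N by (simp add: negligible_Un negligible_finite)
  then have N'_null: "N' \<in> null_sets lebesgue" by (simp add: negligible_iff_null_sets)
  obtain G where G: "open G" "N' \<subseteq> G" "G - N' \<in> lmeasurable" "emeasure lebesgue (G - N') < ennreal d"
    using sets_lebesgue_outer_open[of N' d] N'_null d(1) by blast
  have Gm: "G \<in> lmeasurable" 
    using fmeasurable.Un[OF G(3) negligible_imp_measurable[OF N']] G(2) by (simp add: Un_absorb2 Un_commute)
  have "emeasure lebesgue G = emeasure lebesgue (G - N')"
    using G(1) N'_null by (simp add: emeasure_Diff_null_set)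
  then have mG: "measure lebesgue G < d"
    using G(4) Gm d(1) by (metis emeasure_eq_measure2 ennreal_less_iff measure_nonneg)
  have ex_ball: "\<exists>r>0. \<forall>y\<in>{a..b}. \<bar>y - x\<bar> < r \<longrightarrow> (x \<le> y \<longrightarrow> f y - f x \<le> e * (y - x)) \<and> (y \<le> x \<longrightarrow> f x - f y \<le> e * (x - y))"
    if x: "x \<in> {a..b}" "x \<notin> N'" for x
  proof -
    have "x \<in> {a<..<b}" "x \<notin> N" using x unfolding N'_def by auto
    then obtain D where D: "D \<le> 0" "(f has_real_derivative D) (at x)" using der by blast
    then obtain r where r: "0 < r" "\<And>y. norm (y - x) < r \<Longrightarrow> norm (f y - f x - D * (y - x)) \<le> e * norm (y - x)"
      using e(1) unfolding has_field_derivative_def has_derivative_at_alt by blast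
    show ?thesis
    proof (intro exI conjI ballI impI)
      fix y assume y: "\<bar>y - x\<bar> < r"
      have n: "\<bar>f y - f x - D * (y - x)\<bar> \<le> e * \<bar>y - x\<bar>" using r(2) y by simp
      { assume "x \<le> y"
        then have "D * (y - x) \<le> 0" using D(1) by (simp add: mult_nonpos_nonneg)
        then show "f y - f x \<le> e * (y - x)" using n \<open>x \<le> y\<close> by auto }
      { assume "y \<le> x"
        then have "D * (y - x) \<ge> 0" using D(1) by (simp add: mult_nonpos_nonpos)
        then show "f x - f y \<le> e * (x - y)" using n \<open>y \<le> x\<close> by auto }
    qed (fact r)
  qed
  then have "\<forall>x\<in>{a..b} - N'. \<exists>r>0. \<forall>y\<in>{a..b}. \<bar>y - x\<bar> < r \<longrightarrow>
      (x \<le> y \<longrightarrow> f y - f x \<le> e * (y - x)) \<and> (y \<le> x \<longrightarrow> f x - f y \<le> e * (x - y))"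
    by blast
  from bchoice[OF this] obtain R where R': "\<forall>x\<in>{a..b} - N'. 0 < R x \<and> (\<forall>y\<in>{a..b}. \<bar>y - x\<bar> < R x \<longrightarrow>
      (x \<le> y \<longrightarrow> f y - f x \<le> e * (y - x)) \<and> (y \<le> x \<longrightarrow> f x - f y \<le> e * (x - y)))"
    by (elim exE)
  then have R: "\<And>x. x \<in> {a..b} \<Longrightarrow> x \<notin> N' \<Longrightarrow> 0 < R x"
    "\<And>x y. x \<in> {a..b} \<Longrightarrow> x \<notin> N' \<Longrightarrow> y \<in> {a..b} \<Longrightarrow> \<bar>y - x\<bar> < R x \<Longrightarrow> x \<le> y \<Longrightarrow> f y - f x \<le> e * (y - x)"
    "\<And>x y. x \<in> {a..b} \<Longrightarrow> x \<notin> N' \<Longrightarrow> y \<in> {a..b} \<Longrightarrow> \<bar>y - x\<bar> < R x \<Longrightarrow> y \<le> x \<Longrightarrow> f x - f y \<le> e * (x - y)"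
    by simp_all
  \<comment> \<open>The value \<open>UNIV\<close> outside the interval is a default that makes
    \<open>\<gamma>\<close> a gauge; no tag lies there.\<close>
  define \<gamma> where "\<gamma> x = (if x \<in> N' then G else if x \<in> {a..b} then ball x (R x) else UNIV)" for x
  have "gauge \<gamma>" unfolding gauge_def \<gamma>_def using G R(1) by auto
  then obtain p where p: "p tagged_division_of {a..b}" "\<gamma> fine p"
    by (rule fine_division_exists_real)
  \<comment> \<open>The guard matters when tagged intervals are replaced by bare intervals: that
    step requires the summand to vanish on degenerate intervals, and \<open>Sup {}\<close> and
    \<open>Inf {}\<close> are unspecified.\<close>
  define inc where "inc g K = (if K = {} then 0 else g (Sup K) - g (Inf K))" for g :: "real \<Rightarrow> real" and K
  have pK: "Inf K \<le> x \<and> x \<le> Sup K \<and> Inf K \<in> K \<and> Sup K \<in> K \<and> K \<noteq> {} \<and> Inf K \<in> {a..b} \<and> Sup K \<in> {a..b} \<and> K \<subseteq> \<gamma> x"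
    if xK: "(x, K) \<in> p" for x K
  proof -
    obtain u v where "K = {u..v}" "x \<in> K" "K \<subseteq> {a..b}"
      using tagged_division_ofD(2,3,4)[OF p(1) xK] by (metis box_real(2))
    moreover have "K \<subseteq> \<gamma> x" using p(2) xK unfolding fine_def by auto
    ultimately show ?thesis by auto
  qed
  define p1 where "p1 = {(x, K) \<in> p. x \<in> N'}"
  define p2 where "p2 = {(x, K) \<in> p. x \<notin> N'}"
  have finp: "finite p" using p(1) by (rule tagged_division_of_finite)
  have p12: "p = p1 \<union> p2" "p1 \<inter> p2 = {}" "finite p1" "finite p2"
    using finp by (auto simp: p1_def p2_def intro: finite_subset[OF _ finp])
  have split: "sum h p = sum h p1 + sum h p2" for h :: "real \<times> real set \<Rightarrow> real"
    using p12 by (simp add: sum.union_disjoint)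
  have sum_p: "(\<Sum>(x, K)\<in>p. inc g K) = g b - g a" for g
  proof -
    have "(\<Sum>(x, K)\<in>p. inc g K) = (\<Sum>(x, K)\<in>p. g (Sup K) - g (Inf K))"
    proof (intro sum.cong refl, clarify)
      fix x K assume "(x, K) \<in> p"
      then show "inc g K = g (Sup K) - g (Inf K)" using pK[of x K] by (simp add: inc_def)
    qed
    then show ?thesis using additive_tagged_division_1[OF ab p(1), of g] by simp
  qed
  have good: "(\<Sum>(x, K)\<in>p2. inc f K) \<le> e * (b - a)"
  proof -
    have nonneg: "0 \<le> e * inc (\<lambda>t. t) K" if "(x, K) \<in> p" for x K
      using pK[OF that] e(1) by (simp add: inc_def)
    have "(\<Sum>(x, K)\<in>p2. inc f K) \<le> (\<Sum>(x, K)\<in>p2. e * inc (\<lambda>t. t) K)"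
    proof (intro sum_mono, clarify)
      fix x K assume "(x, K) \<in> p2"
      then have xK: "(x, K) \<in> p" "x \<notin> N'" by (auto simp: p2_def)
      note q = pK[OF xK(1)]
      have x: "x \<in> {a..b}" using q by auto
      have "Inf K \<in> \<gamma> x" "Sup K \<in> \<gamma> x" using q by blast+
      then have "\<bar>Inf K - x\<bar> < R x" "\<bar>Sup K - x\<bar> < R x"
        using xK(2) x by (auto simp: \<gamma>_def dist_real_def abs_minus_commute)
      \<comment> \<open>The tag splits the interval into two pieces, and the derivative estimate at
        the tag applies to each.\<close>
      then have "f (Sup K) - f x \<le> e * (Sup K - x)" "f x - f (Inf K) \<le> e * (x - Inf K)"
        using R(2,3)[OF x xK(2)] q by auto
      then have "f (Sup K) - f (Inf K) \<le> e * (Sup K - Inf K)" by (simp add: algebra_simps)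
      then show "inc f K \<le> e * inc (\<lambda>t. t) K" using q by (simp add: inc_def)
    qed
    also have "\<dots> \<le> (\<Sum>(x, K)\<in>p. e * inc (\<lambda>t. t) K)"
      using finp nonneg by (intro sum_mono2) (auto simp: p2_def)
    also have "\<dots> = e * (\<Sum>(x, K)\<in>p. inc (\<lambda>t. t) K)"
      by (simp add: sum_distrib_left case_prod_unfold)
    finally show ?thesis using sum_p[of "\<lambda>t. t"] by simp
  qed
  have bad: "(\<Sum>(x, K)\<in>p1. inc f K) < e"
  proof -
    have "p1 tagged_partial_division_of {a..b}"
      using p(1) by (intro tagged_partial_division_subset[of p "{a..b}" p1]) (auto simp: tagged_division_of_def p1_def)
    then have p1: "p1 tagged_division_of \<Union>(snd ` p1)"
      by (rule tagged_partial_division_of_Union_self)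
    let ?D = "snd ` p1"
    have D: "?D division_of \<Union>?D" using division_of_tagged_division[OF p1] .
    have "K \<subseteq> {a..b}" if "(x, K) \<in> p" for x K using p(1) that by blast
    then have sub: "\<Union>?D \<subseteq> {a..b}" unfolding Sup_le_iff by (auto simp: p1_def)
    \<comment> \<open>The intervals do not overlap and lie in \<open>G\<close>, so their total
      length is at most the measure of \<open>G\<close>, which is below \<open>d\<close>.\<close>
    have "(\<Sum>K\<in>?D. Sup K - Inf K) = (\<Sum>K\<in>?D. measure lebesgue K)"
    proof (rule sum.cong)
      fix K assume "K \<in> ?D"
      note K = division_member_real(3,4)[OF D sub this]
      have "measure lebesgue {Inf K..Sup K} = Sup K - Inf K" using K(1) by simp
      then show "Sup K - Inf K = measure lebesgue K" by (simp flip: K(2))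
    qed simp
    also have "\<dots> = measure lebesgue (\<Union>?D)" by (rule content_division[OF D])
    also have "\<dots> \<le> measure lebesgue G"
    proof (rule measure_mono_fmeasurable[OF _ _ Gm])
      have "K \<subseteq> G" if "(x, K) \<in> p1" for x K
        using that pK[of x K] by (simp add: p1_def \<gamma>_def)
      then show "\<Union>?D \<subseteq> G" unfolding Sup_le_iff by (metis imageE prod.collapse)
    qed (use lmeasurable_division[OF D] in auto)
    finally have "(\<Sum>K\<in>?D. norm (f (Sup K) - f (Inf K))) < e"
      using d(2)[OF D sub] mG by linarith
    moreover have "(\<Sum>(x, K)\<in>p1. inc f K) = (\<Sum>K\<in>?D. inc f K)"
      by (rule sum.over_tagged_division_lemma[OF p1]) (auto simp: inc_def)
    moreover have "(\<Sum>K\<in>?D. inc f K) \<le> (\<Sum>K\<in>?D. norm (f (Sup K) - f (Inf K)))"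
      by (intro sum_mono) (auto simp: inc_def)
    ultimately show ?thesis by linarith
  qed
  show False using good bad e(2) sum_p[of f] split[of "\<lambda>(x, K). inc f K"] by linarith
qed

text \<open>If \<open>g\<close> became positive, let \<open>Inf A\<close> be the first time it
  reaches a level \<open>c\<close> below \<open>\<eta>\<close>, and \<open>Sup B\<close> the last
  time before that with \<open>g\<close> at most zero. In between, \<open>g\<close> stays strictly
  inside the strip from 0 to \<open>\<eta>\<close>, hence cannot increase, although it climbs from
  at most 0 to \<open>c\<close>. The bound \<open>\<eta>\<close> allows for a slope that is known
  only in a thin strip.\<close>

lemma abs_continuous_barrier:
  fixes g :: "real \<Rightarrow> real"
  assumes ac: "abs_continuous_on a b g" and ab: "a \<le> b" and N: "negligible N"
    and "g a \<le> 0" and "0 < \<eta>"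
    and der: "\<And>t. t \<in> {a<..<b} \<Longrightarrow> t \<notin> N \<Longrightarrow> 0 < g t \<Longrightarrow> g t < \<eta> \<Longrightarrow>
      \<exists>D\<le>0. (g has_real_derivative D) (at t)"
  shows "g b \<le> 0"
proof (rule ccontr)
  assume "\<not> g b \<le> 0"
  define c where "c = min (g b) (\<eta> / 2)"
  have c: "0 < c" "c \<le> g b" "c < \<eta>" using \<open>\<not> g b \<le> 0\<close> \<open>0 < \<eta>\<close> by (auto simp: c_def)
  note cont = abs_continuous_on_imp_continuous_on[OF ac]
  define A where "A = {u \<in> {a..b}. c \<le> g u}"
  have "closed A" unfolding A_def using cont by (intro continuous_on_closed_Collect_le) auto
  moreover have "b \<in> A" "bdd_below A" using c ab by (auto simp: A_def intro: bdd_belowI)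
  ultimately have t': "Inf A \<in> A" using closed_contains_Inf by blast
  have lt: "g u < c" if "u \<in> {a..<Inf A}" for u
    using that t' cInf_lower[OF _ \<open>bdd_below A\<close>, of u] by (force simp: A_def)
  define B where "B = {u \<in> {a..Inf A}. g u \<le> 0}"
  have cont': "continuous_on {a..Inf A} g" using cont t' by (auto simp: A_def intro: continuous_on_subset)
  have "closed B" unfolding B_def using cont' by (intro continuous_on_closed_Collect_le) auto
  moreover have "a \<in> B" "bdd_above B" using \<open>g a \<le> 0\<close> t' by (auto simp: A_def B_def intro: bdd_aboveI)
  ultimately have s: "Sup B \<in> B" using closed_contains_Sup by blast
  have gt: "0 < g u" if "u \<in> {Sup B<..Inf A}" for u
    using that s cSup_upper[OF _ \<open>bdd_above B\<close>, of u] by (force simp: B_def)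
  have "g (Inf A) \<le> g (Sup B)"
  proof (rule abs_continuous_nonincreasing[of "Sup B" "Inf A" g, OF _ _ N])
    show "abs_continuous_on (Sup B) (Inf A) g"
      using s t' by (auto simp: A_def B_def intro: abs_continuous_on_subinterval[OF ac])
    fix t assume t: "t \<in> {Sup B<..<Inf A}" "t \<notin> N"
    then have "t \<in> {a<..<b}" using s t' by (auto simp: A_def B_def)
    then show "\<exists>D\<le>0. (g has_real_derivative D) (at t)"
      using t lt[of t] gt[of t] c by (intro der) auto
  qed (use s in \<open>auto simp: B_def\<close>)
  then show False using s t' c by (auto simp: A_def B_def)
qed

section \<open>Extremal directions\<close>

lemma inner_unit_dir: "unit_dir s \<bullet> unit_dir t = cos (s - t)"
  by (simp add: unit_dir_def inner_vec_def sum_2 cos_diff)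

lemma norm_unit_dir [simp]: "norm (unit_dir s) = 1"
  by (simp add: norm_eq_sqrt_inner inner_unit_dir)

lemma unit_dir_eq_iff: "unit_dir s = unit_dir t \<longleftrightarrow> (\<exists>n::int. s = t + 2 * pi * n)"
  by (auto simp: unit_dir_def vec_eq_iff forall_2 simp flip: sin_cos_eq_iff)

lemma sgn_scaleR_unit_dir: "0 < r \<Longrightarrow> sgn (r *\<^sub>R unit_dir s) = unit_dir s"
  by (simp add: sgn_scaleR) (simp add: sgn_div_norm)

text \<open>The window of angles can be centred at will, so that the angle found is directly
  comparable with that of a reference direction.\<close>

lemma polar_real2:
  fixes v :: "real^2"
  obtains t where "c - pi < t" "t \<le> c + pi" "v = norm v *\<^sub>R unit_dir t"
proof -
  obtain s where s: "v = norm v *\<^sub>R unit_dir s"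
  proof (cases "v = 0")
    case False
    have "(norm v)\<^sup>2 = (v $ 1)\<^sup>2 + (v $ 2)\<^sup>2"
      by (simp add: norm_vec_def L2_set_def sum_2)
    then have "(v $ 1 / norm v)\<^sup>2 + (v $ 2 / norm v)\<^sup>2 = 1"
      using False by (metis add_divide_distrib divide_self power_divide power_not_zero norm_eq_zero)
    then obtain t where "v $ 1 / norm v = cos t" "v $ 2 / norm v = sin t"
      using sincos_total_2pi by blast
    then have "v $ 1 = norm v * cos t" "v $ 2 = norm v * sin t"
      using False by (simp_all add: divide_eq_eq mult.commute)
    then show thesis by (intro that[of t]) (simp add: vec_eq_iff forall_2 unit_dir_def)
  qed (use that in auto)
  obtain y where y: "- pi < y" "y \<le> pi" "sin y = sin (s - c)" "cos y = cos (s - c)"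
    using sincos_principal_value by blast
  then obtain n :: int where "y = s - c + 2 * pi * n" using sin_cos_eq_iff by blast
  then have "unit_dir (c + y) = unit_dir s" by (simp add: unit_dir_eq_iff)
  then show thesis using y s by (intro that[of "c + y"]) auto
qed

lemma norm_scaleR_sgn: "norm v *\<^sub>R sgn v = v"
  by (cases "v = 0") (simp_all add: sgn_div_norm)

lemma mem_sector_iff:
  assumes "x \<noteq> a"
  shows "x \<in> sector a \<theta> \<phi> \<longleftrightarrow> (\<exists>s. \<theta> \<le> s \<and> s \<le> \<theta> + \<phi> \<and> sgn (x - a) = unit_dir s)"
proof
  assume "x \<in> sector a \<theta> \<phi>"
  then obtain r s where "x = a + r *\<^sub>R unit_dir s" "0 \<le> r" "\<theta> \<le> s" "s \<le> \<theta> + \<phi>"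
    unfolding sector_def by blast
  moreover from this have "0 < r" using assms by (cases "r = 0") auto
  ultimately show "\<exists>s. \<theta> \<le> s \<and> s \<le> \<theta> + \<phi> \<and> sgn (x - a) = unit_dir s"
    using sgn_scaleR_unit_dir by auto
next
  assume "\<exists>s. \<theta> \<le> s \<and> s \<le> \<theta> + \<phi> \<and> sgn (x - a) = unit_dir s"
  then obtain s where "\<theta> \<le> s" "s \<le> \<theta> + \<phi>" "sgn (x - a) = unit_dir s" by blast
  moreover from this have "x = a + norm (x - a) *\<^sub>R unit_dir s"
    by (metis add.commute diff_add_cancel norm_scaleR_sgn)
  ultimately show "x \<in> sector a \<theta> \<phi>" unfolding sector_def mem_Collect_eq by (metis norm_ge_zero)
qed

lemma angular_span_le:
  assumes "0 \<le> \<phi>" "X \<subseteq> sector a \<theta> \<phi>"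
  shows "angular_span a X \<le> \<phi>"
  unfolding angular_span_def using assms by (intro cInf_lower) (auto intro: bdd_belowI)

text \<open>Each point is seen at an angle of less than \<open>pi / 2\<close> from \<open>w\<close>.
  By finiteness the largest of these angles is still below \<open>pi / 2\<close>, and twice that
  angle is the opening of a sector centred on \<open>w\<close> that contains
  \<open>X\<close>.\<close>

lemma angular_span_less_pi:
  assumes "finite X" and pos: "\<And>x. x \<in> X \<Longrightarrow> 0 < w \<bullet> (x - a)"
  shows "angular_span a X < pi"
proof -
  obtain \<beta> where \<beta>: "w = norm w *\<^sub>R unit_dir \<beta>" using polar_real2[of 0 w] by metis
  have "\<exists>s. \<bar>s - \<beta>\<bar> < pi / 2 \<and> sgn (x - a) = unit_dir s" if "x \<in> X" for x
  proof -
    obtain s where s: "\<beta> - pi < s" "s \<le> \<beta> + pi" "x - a = norm (x - a) *\<^sub>R unit_dir s"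
      using polar_real2 by blast
    have ne: "w \<noteq> 0" "x - a \<noteq> 0" using pos[OF that] by auto
    have "w \<bullet> (x - a) = norm w * norm (x - a) * cos (s - \<beta>)"
      by (subst \<beta>, subst s(3)) (simp add: inner_unit_dir cos_diff)
    moreover have "0 < norm w * norm (x - a)" using ne by simp
    ultimately have "0 < cos (s - \<beta>)" using pos[OF that] by (metis zero_less_mult_pos)
    moreover have "cos (s - \<beta>) = cos \<bar>s - \<beta>\<bar>" by simp
    moreover have "cos \<bar>s - \<beta>\<bar> \<le> cos (pi / 2)" if "pi / 2 \<le> \<bar>s - \<beta>\<bar>"
      using that s by (intro cos_monotone_0_pi_le) auto
    ultimately have "\<bar>s - \<beta>\<bar> < pi / 2" by (metis cos_pi_half leI not_less)
    moreover have "sgn (x - a) = unit_dir s"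
      using sgn_scaleR_unit_dir[of "norm (x - a)" s] ne by (simp flip: s(3))
    ultimately show ?thesis by blast
  qed
  then obtain s where s: "\<And>x. x \<in> X \<Longrightarrow> \<bar>s x - \<beta>\<bar> < pi / 2" "\<And>x. x \<in> X \<Longrightarrow> sgn (x - a) = unit_dir (s x)"
    by metis
  \<comment> \<open>Inserting 0 makes the maximum meaningful for empty \<open>X\<close> and the
    opening nonnegative.\<close>
  define \<gamma> where "\<gamma> = Max (insert 0 ((\<lambda>x. \<bar>s x - \<beta>\<bar>) ` X))"
  have \<gamma>: "\<gamma> < pi / 2" "0 \<le> \<gamma>" "\<And>x. x \<in> X \<Longrightarrow> \<bar>s x - \<beta>\<bar> \<le> \<gamma>"
    using s(1) \<open>finite X\<close> by (auto simp: \<gamma>_def Max_less_iff simp del: Max_insert less_divide_eq_numeral1)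
  have "X \<subseteq> sector a (\<beta> - \<gamma>) (2 * \<gamma>)"
  proof
    fix x assume x: "x \<in> X"
    then have "x \<noteq> a" using pos by force
    then show "x \<in> sector a (\<beta> - \<gamma>) (2 * \<gamma>)"
      using \<gamma>(3)[OF x] s(2)[OF x] by (auto simp: mem_sector_iff intro!: exI[of _ "s x"])
  qed
  then show ?thesis using angular_span_le[of "2 * \<gamma>" X] \<gamma> by fastforce
qed

text \<open>If the span is below \<open>\<pi>\<close>, any sector of opening below \<open>\<pi>\<close> assigns angles to the points of
  \<open>X\<close>; their extreme values determine the minimal sector, because angles inside two such sectors
  differ by a common multiple of \<open>2\<pi>\<close>.\<close>

lemma extremal_directions:
  assumes fin: "finite X" "X \<noteq> {}" "a \<notin> X" and span: "angular_span a X < pi"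
  obtains x y where "x \<in> X" "right_extremal a X = sgn (x - a)"
    and "y \<in> X" "left_extremal a X = sgn (y - a)"
    and "\<And>z. z \<in> X \<Longrightarrow> 0 \<le> (right_extremal a X + left_extremal a X) \<bullet> (z - a)"
proof -
  let ?S = "{\<phi>. 0 \<le> \<phi> \<and> (\<exists>\<theta>. X \<subseteq> sector a \<theta> \<phi>)}"
  have ne: "x \<noteq> a" if "x \<in> X" for x using that fin by auto
  \<comment> \<open>The full turn shows that the infimum defining the span is taken over a nonempty
    set.\<close>
  have "X \<subseteq> sector a (- pi) (2 * pi)"
  proof
    fix x assume x: "x \<in> X"
    obtain t where "- pi < t" "t \<le> pi" "x - a = norm (x - a) *\<^sub>R unit_dir t"
      using polar_real2[of 0 "x - a"] by auto
    then show "x \<in> sector a (- pi) (2 * pi)"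
      using sgn_scaleR_unit_dir[of "norm (x - a)" t] ne[OF x]
      by (auto simp: mem_sector_iff intro!: exI[of _ t])
  qed
  then have "2 * pi \<in> ?S" by auto
  then have "?S \<noteq> {}" by blast
  then obtain \<phi>\<^sub>1 \<theta>\<^sub>1 where \<phi>\<^sub>1: "0 \<le> \<phi>\<^sub>1" "\<phi>\<^sub>1 < pi" "X \<subseteq> sector a \<theta>\<^sub>1 \<phi>\<^sub>1"
    using span cInf_lessD[of ?S pi] unfolding angular_span_def by blast
  then have "\<forall>x\<in>X. \<exists>s. \<theta>\<^sub>1 \<le> s \<and> s \<le> \<theta>\<^sub>1 + \<phi>\<^sub>1 \<and> sgn (x - a) = unit_dir s"
    using ne mem_sector_iff by blast
  from bchoice[OF this] obtain \<alpha> where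
    \<alpha>: "\<forall>x\<in>X. \<theta>\<^sub>1 \<le> \<alpha> x \<and> \<alpha> x \<le> \<theta>\<^sub>1 + \<phi>\<^sub>1 \<and> sgn (x - a) = unit_dir (\<alpha> x)" by blast
  obtain x where x: "x \<in> X" "\<And>z. z \<in> X \<Longrightarrow> \<alpha> x \<le> \<alpha> z"
    using fin(1,2) by (metis ex_is_arg_min_if_finite is_arg_min_linorder)
  obtain y where y: "y \<in> X" "\<And>z. z \<in> X \<Longrightarrow> \<alpha> z \<le> \<alpha> y"
  proof -
    have "Max (\<alpha> ` X) \<in> \<alpha> ` X" using fin by (intro Max_in) auto
    then obtain y where "y \<in> X" "\<alpha> y = Max (\<alpha> ` X)" by auto
    then show thesis using fin by (intro that[of y]) auto
  qed
  define \<Delta> where "\<Delta> = \<alpha> y - \<alpha> x"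
  have "\<theta>\<^sub>1 \<le> \<alpha> x" "\<alpha> y \<le> \<theta>\<^sub>1 + \<phi>\<^sub>1" using \<alpha> x(1) y(1) by auto
  then have \<Delta>: "0 \<le> \<Delta>" "\<Delta> < pi" using x(2)[OF y(1)] \<phi>\<^sub>1(2) by (auto simp: \<Delta>_def)
  have angles: "\<exists>s. \<theta> \<le> s \<and> s + \<Delta> \<le> \<theta> + \<phi> \<and> unit_dir s = unit_dir (\<alpha> x) \<and>
      unit_dir (s + \<Delta>) = unit_dir (\<alpha> y)"
    if sec: "X \<subseteq> sector a \<theta> \<phi>" "\<phi> < pi" for \<theta> \<phi>
  proof -
    obtain s where s: "\<theta> \<le> s" "s \<le> \<theta> + \<phi>" "unit_dir s = unit_dir (\<alpha> x)"
      using sec(1) x(1) \<alpha> ne mem_sector_iff by (metis subsetD)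
    obtain t where t: "\<theta> \<le> t" "t \<le> \<theta> + \<phi>" "unit_dir t = unit_dir (\<alpha> y)"
      using sec(1) y(1) \<alpha> ne mem_sector_iff by (metis subsetD)
    obtain m n :: int where "s = \<alpha> x + 2 * pi * m" "t = \<alpha> y + 2 * pi * n"
      using s(3) t(3) unit_dir_eq_iff by blast
    then have k: "t - s = \<Delta> + 2 * pi * of_int (n - m)" by (simp add: \<Delta>_def algebra_simps)
    have "\<bar>t - s\<bar> < pi" using s t sec(2) by linarith
    \<comment> \<open>Both \<open>t - s\<close> and \<open>\<Delta>\<close> have absolute value
      below \<open>pi\<close>, so the multiple of \<open>2 * pi\<close> by which they differ is
      zero.\<close>
    with k \<Delta> have "2 * pi * of_int (n - m) < 2 * pi * 1" "2 * pi * (-1) < 2 * pi * of_int (n - m)"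
      by linarith+
    then have "of_int (n - m) < (1::real)" "(-1::real) < of_int (n - m)"
      by (simp_all only: mult_less_cancel_left_pos pi_gt_zero mult_pos_pos zero_less_numeral)
    then have "n - m = 0" by linarith
    then have "t = s + \<Delta>" using k by simp
    then show ?thesis using s t by auto
  qed
  have sec: "X \<subseteq> sector a (\<alpha> x) \<Delta>"
    using x(2) y(2) \<alpha> ne by (force simp: \<Delta>_def mem_sector_iff)
  have eq: "angular_span a X = \<Delta>"
  proof (rule antisym)
    show "angular_span a X \<le> \<Delta>" using \<Delta>(1) sec by (rule angular_span_le)
    have "\<Delta> \<le> \<phi>" if "\<phi> \<in> ?S" for \<phi>
      using that angles[of _ \<phi>] \<Delta> by (cases "\<phi> < pi") force+
    then show "\<Delta> \<le> angular_span a X"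
      unfolding angular_span_def using \<open>?S \<noteq> {}\<close> by (intro cInf_greatest) auto
  qed
  have right: "right_extremal a X = unit_dir (\<alpha> x)"
    unfolding right_extremal_def eq
  proof (rule the_equality)
    show "\<exists>\<theta>. X \<subseteq> sector a \<theta> \<Delta> \<and> (\<exists>z\<in>X. unit_dir (\<alpha> x) = sgn (z - a) \<and> unit_dir (\<alpha> x) = unit_dir \<theta>)"
      using sec x(1) \<alpha> by metis
    fix u assume "\<exists>\<theta>. X \<subseteq> sector a \<theta> \<Delta> \<and> (\<exists>z\<in>X. u = sgn (z - a) \<and> u = unit_dir \<theta>)"
    then obtain \<theta> where \<theta>: "X \<subseteq> sector a \<theta> \<Delta>" "u = unit_dir \<theta>" by blast
    with angles[OF \<theta>(1) \<Delta>(2)] show "u = unit_dir (\<alpha> x)" by (metis add_le_cancel_right antisym)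
  qed
  have left: "left_extremal a X = unit_dir (\<alpha> y)"
    unfolding left_extremal_def eq
  proof (rule the_equality)
    have "\<alpha> x + \<Delta> = \<alpha> y" by (simp add: \<Delta>_def)
    then show "\<exists>\<theta>. X \<subseteq> sector a \<theta> \<Delta> \<and> (\<exists>z\<in>X. unit_dir (\<alpha> y) = sgn (z - a) \<and> unit_dir (\<alpha> y) = unit_dir (\<theta> + \<Delta>))"
      using sec y(1) \<alpha> by metis
    fix u assume "\<exists>\<theta>. X \<subseteq> sector a \<theta> \<Delta> \<and> (\<exists>z\<in>X. u = sgn (z - a) \<and> u = unit_dir (\<theta> + \<Delta>))"
    then obtain \<theta> where \<theta>: "X \<subseteq> sector a \<theta> \<Delta>" "u = unit_dir (\<theta> + \<Delta>)" by blast
    with angles[OF \<theta>(1) \<Delta>(2)] show "u = unit_dir (\<alpha> y)" by (metis add_le_cancel_right antisym)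
  qed
  show thesis
  proof (rule that[OF x(1) _ y(1)])
    show "right_extremal a X = sgn (x - a)" "left_extremal a X = sgn (y - a)"
      using right left x(1) y(1) \<alpha> by auto
    fix z assume z: "z \<in> X"
    define b c where "b = \<alpha> z - \<alpha> x" and "c = \<alpha> y - \<alpha> z"
    have bc: "0 \<le> b" "0 \<le> c" "b + c < pi"
      using x(2)[OF z] y(2)[OF z] \<Delta>(2) by (auto simp: b_def c_def \<Delta>_def)
    \<comment> \<open>Half the sum and half the difference of \<open>b\<close> and \<open>c\<close>
      both lie between \<open>- pi / 2\<close> and \<open>pi / 2\<close>, so both cosines in the
      product are nonnegative.\<close>
    have "cos b + cos c = 2 * cos ((b + c) / 2) * cos ((b - c) / 2)" by (rule cos_plus_cos)
    also have "\<dots> \<ge> 0"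
      using bc by (intro mult_nonneg_nonneg cos_ge_zero) auto
    finally have "0 \<le> cos b + cos c" .
    moreover have "(right_extremal a X + left_extremal a X) \<bullet> unit_dir (\<alpha> z) = cos b + cos c"
      unfolding right left b_def c_def inner_add_left inner_unit_dir
      by (metis cos_minus minus_diff_eq)
    moreover have "z - a = norm (z - a) *\<^sub>R unit_dir (\<alpha> z)"
      using \<alpha> z by (metis norm_scaleR_sgn)
    ultimately show "0 \<le> (right_extremal a X + left_extremal a X) \<bullet> (z - a)"
      by (metis inner_scaleR_right mult_nonneg_nonneg norm_ge_zero)
  qed
qed

section \<open>The velocity field\<close>

lemma velocity_no_band:
  "band_neighbours V \<delta> x i = {} \<Longrightarrow> velocity V \<delta> \<sigma> x i = \<sigma> *\<^sub>R (\<Sum>j\<in>neighbours V x i. x j - x i)"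
  by (simp add: velocity_def)

lemma velocity_obtuse:
  "band_neighbours V \<delta> x i \<noteq> {} \<Longrightarrow> pi \<le> angular_span (x i) (x ` band_neighbours V \<delta> x i) \<Longrightarrow>
    velocity V \<delta> \<sigma> x i = 0"
  by (simp add: velocity_def)

lemma velocity_band:
  fixes x :: "'n::finite \<Rightarrow> real^2"
  assumes "\<delta> < V" "0 < \<sigma>" and ne: "band_neighbours V \<delta> x i \<noteq> {}"
    and span: "angular_span (x i) (x ` band_neighbours V \<delta> x i) < pi"
  obtains j k where "j \<in> band_neighbours V \<delta> x i" "k \<in> band_neighbours V \<delta> x i"
    and "velocity V \<delta> \<sigma> x i = \<sigma> *\<^sub>R (sgn (x j - x i) + sgn (x k - x i))"
    and "\<And>l. l \<in> band_neighbours V \<delta> x i \<Longrightarrow> 0 \<le> velocity V \<delta> \<sigma> x i \<bullet> (x l - x i)"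
proof -
  let ?B = "x ` band_neighbours V \<delta> x i"
  have vel: "velocity V \<delta> \<sigma> x i = \<sigma> *\<^sub>R (right_extremal (x i) ?B + left_extremal (x i) ?B)"
    using ne span by (simp add: velocity_def)
  have "x i \<notin> ?B" using \<open>\<delta> < V\<close> by (auto simp: band_neighbours_def)
  then obtain u w where "u \<in> ?B" "right_extremal (x i) ?B = sgn (u - x i)"
    and "w \<in> ?B" "left_extremal (x i) ?B = sgn (w - x i)"
    and nn: "\<And>z. z \<in> ?B \<Longrightarrow> 0 \<le> (right_extremal (x i) ?B + left_extremal (x i) ?B) \<bullet> (z - x i)"
    using extremal_directions[of ?B "x i"] ne span by auto
  moreover have "0 \<le> velocity V \<delta> \<sigma> x i \<bullet> (x l - x i)" if "l \<in> band_neighbours V \<delta> x i" for l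
    using nn[of "x l"] that \<open>0 < \<sigma>\<close> unfolding vel by (simp add: inner_scaleR_left)
  ultimately show thesis using vel that by auto
qed

lemma velocity_towards_band:
  fixes x :: "'n::finite \<Rightarrow> real^2"
  assumes "\<delta> < V" "0 < \<sigma>" "j \<in> band_neighbours V \<delta> x i"
  shows "0 \<le> velocity V \<delta> \<sigma> x i \<bullet> (x j - x i)"
proof (cases "angular_span (x i) (x ` band_neighbours V \<delta> x i) < pi")
  case True
  then show ?thesis using assms velocity_band[of \<delta> V \<sigma> x i] by blast
next
  case False
  then show ?thesis using assms velocity_obtuse[of V \<delta> x i \<sigma>] by (metis empty_iff inner_zero_left linorder_not_le order_refl)
qed

text \<open>Being in each other's band is symmetric, and neither agent moves away from a band
  neighbour to first order. The inner product is half the derivative of the squared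
  distance.\<close>

lemma band_neighbours_not_separating:
  fixes x :: "'n::finite \<Rightarrow> real^2"
  assumes "\<delta> < V" "0 < \<sigma>" "i \<noteq> j" "V - \<delta> \<le> norm (x i - x j)" "norm (x i - x j) < V"
  shows "(x i - x j) \<bullet> (velocity V \<delta> \<sigma> x i - velocity V \<delta> \<sigma> x j) \<le> 0"
proof -
  have "j \<in> band_neighbours V \<delta> x i" "i \<in> band_neighbours V \<delta> x j"
    using assms by (auto simp: band_neighbours_def neighbours_def norm_minus_commute)
  then have "0 \<le> velocity V \<delta> \<sigma> x i \<bullet> (x j - x i)" "0 \<le> velocity V \<delta> \<sigma> x j \<bullet> (x i - x j)"
    using assms velocity_towards_band by blast+
  then show ?thesis by (simp add: algebra_simps inner_commute)
qed

section \<open>Outward speed of an agent in terms of deficits\<close>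

text \<open>The first summand serves an empty band: at most \<open>n\<close> neighbours each
  contribute the agent's own deficit, and one further copy covers \<open>k = i\<close>. The second
  serves a nonempty band, where two unit vectors point to agents at distance at least
  \<open>V - \<delta>\<close>.\<close>

definition decay_rate :: "real \<Rightarrow> real \<Rightarrow> real \<Rightarrow> nat \<Rightarrow> real" where
  "decay_rate V \<delta> \<sigma> n = \<sigma> * (real n + 1) + 2 * \<sigma> / (V - \<delta>)"

text \<open>The law of cosines. It turns the radial component of a motion from \<open>a\<close>
  towards \<open>b\<close> into a difference of squared distances from \<open>z\<close>, hence of
  deficits.\<close>

lemma inner_difference_eq:
  fixes a b z :: "'a::real_inner"
  shows "2 * ((a - z) \<bullet> (b - a)) = (norm (b - z))\<^sup>2 - (norm (a - z))\<^sup>2 - (norm (b - a))\<^sup>2"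
  by (simp add: power2_norm_eq_inner algebra_simps inner_commute)

text \<open>If the band neighbours do not fit into a sector below \<open>\<pi>\<close>, the agent rests, but then it cannot be
  close to maximal distance from \<open>z\<close>: otherwise its band neighbours, being at least \<open>V - \<delta>\<close> away, would
  all lie in the open half-plane towards \<open>z\<close>. Hence the same bound holds in both band cases. The case
  \<open>k = i\<close> gives the bound without a neighbour.\<close>

lemma velocity_inner_le:
  fixes x :: "'n::finite \<Rightarrow> real^2" and z :: "real^2"
  assumes "\<delta> < V" "0 < \<sigma>" and m: "\<And>l. (norm (x l - z))\<^sup>2 \<le> m" and k: "k = i \<or> k \<in> neighbours V x i"
  shows "2 * ((x i - z) \<bullet> velocity V \<delta> \<sigma> x i) \<le>
    decay_rate V \<delta> \<sigma> CARD('n) * (m - (norm (x i - z))\<^sup>2) - \<sigma> * min (m - (norm (x k - z))\<^sup>2) (2 * (V - \<delta>))"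
proof -
  let ?y = "\<lambda>l. (norm (x l - z))\<^sup>2"
  let ?C = "decay_rate V \<delta> \<sigma> CARD('n)"
  let ?d = "V - \<delta>"
  let ?q = "m - ?y i"
  have d: "0 < ?d" using assms by simp
  have q: "0 \<le> ?q" using m[of i] by simp
  show ?thesis
  proof (cases "band_neighbours V \<delta> x i = {}")
    case True
    let ?N = "neighbours V x i"
    have "2 * ((x i - z) \<bullet> velocity V \<delta> \<sigma> x i) = \<sigma> * (\<Sum>j\<in>?N. 2 * ((x i - z) \<bullet> (x j - x i)))"
      by (simp add: velocity_no_band[OF True] inner_sum_right sum_distrib_left mult_ac)
    also have "(\<Sum>j\<in>?N. 2 * ((x i - z) \<bullet> (x j - x i))) \<le> (\<Sum>j\<in>?N. ?q - (m - ?y j))"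
      by (intro sum_mono) (simp add: inner_difference_eq)
    also have "\<dots> = real (card ?N) * ?q - (\<Sum>j\<in>?N. m - ?y j)"
      by (subst sum_subtractf) (simp only: sum_constant)
    also have "\<dots> \<le> (real CARD('n) + 1) * ?q - (m - ?y k)"
    proof -
      have "real (card ?N) * ?q \<le> real CARD('n) * ?q"
        using q by (intro mult_right_mono) (simp_all add: card_mono)
      \<comment> \<open>The extra \<open>?q\<close> is what covers \<open>k = i\<close>, which is
        not an index of the sum.\<close>
      moreover have "m - ?y k \<le> ?q + (\<Sum>j\<in>?N. m - ?y j)"
      proof (cases "k = i")
        case True
        then show ?thesis using m by (simp add: sum_nonneg)
      next
        case False
        then have "m - ?y k \<le> (\<Sum>j\<in>?N. m - ?y j)" using k m by (intro member_le_sum) auto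
        then show ?thesis using q by linarith
      qed
      ultimately show ?thesis by (simp add: algebra_simps)
    qed
    finally have "2 * ((x i - z) \<bullet> velocity V \<delta> \<sigma> x i) \<le> \<sigma> * ((real CARD('n) + 1) * ?q - (m - ?y k))"
      using \<open>0 < \<sigma>\<close> by simp
    also have "\<dots> \<le> \<sigma> * ((real CARD('n) + 1) * ?q - min (m - ?y k) (2 * ?d))"
      using \<open>0 < \<sigma>\<close> by (intro mult_left_mono) auto
    also have "\<dots> \<le> ?C * ?q - \<sigma> * min (m - ?y k) (2 * ?d)"
    proof -
      have "0 \<le> 2 * \<sigma> / ?d * ?q" using \<open>0 < \<sigma>\<close> d q by simp
      moreover have "?C * ?q = \<sigma> * ((real CARD('n) + 1) * ?q) + 2 * \<sigma> / ?d * ?q"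
        by (simp only: decay_rate_def distrib_right mult.assoc)
      ultimately show ?thesis by (simp add: right_diff_distrib)
    qed
    finally show ?thesis .
  next
    case False
    have bound: "2 * ((x i - z) \<bullet> velocity V \<delta> \<sigma> x i) \<le> 2 * \<sigma> * (?q / ?d - ?d)"
    proof (cases "angular_span (x i) (x ` band_neighbours V \<delta> x i) < pi")
      case True
      then obtain j l where j: "j \<in> band_neighbours V \<delta> x i" and l: "l \<in> band_neighbours V \<delta> x i"
        and v: "velocity V \<delta> \<sigma> x i = \<sigma> *\<^sub>R (sgn (x j - x i) + sgn (x l - x i))"
        using velocity_band[OF assms(1,2) False] by blast
      \<comment> \<open>The contribution of one unit vector is at most \<open>?q / r - r\<close>,
        which decreases in the distance \<open>r\<close>, so \<open>r\<close> may be replaced by its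
        least value \<open>V - \<delta>\<close>.\<close>
      have *: "2 * ((x i - z) \<bullet> sgn (x j - x i)) \<le> ?q / ?d - ?d" if "j \<in> band_neighbours V \<delta> x i" for j
      proof -
        define r where "r = norm (x j - x i)"
        have r: "?d \<le> r" using that by (simp add: r_def band_neighbours_def norm_minus_commute)
        have "2 * ((x i - z) \<bullet> sgn (x j - x i)) = 2 * ((x i - z) \<bullet> (x j - x i)) / r"
          by (simp add: sgn_div_norm r_def divide_inverse)
        also have "\<dots> \<le> (?q - r\<^sup>2) / r"
          unfolding inner_difference_eq using m[of j] r d by (intro divide_right_mono) (auto simp: r_def)
        also have "\<dots> = ?q / r - r" using r d by (simp add: diff_divide_distrib power2_eq_square)
        also have "\<dots> \<le> ?q / ?d - ?d" using r d q by (intro diff_mono divide_left_mono) auto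
        finally show ?thesis .
      qed
      have "2 * ((x i - z) \<bullet> velocity V \<delta> \<sigma> x i) =
          \<sigma> * (2 * ((x i - z) \<bullet> sgn (x j - x i)) + 2 * ((x i - z) \<bullet> sgn (x l - x i)))"
        by (simp add: v inner_add_right algebra_simps)
      also have "\<dots> \<le> \<sigma> * ((?q / ?d - ?d) + (?q / ?d - ?d))"
        using *[OF j] *[OF l] \<open>0 < \<sigma>\<close> by (intro mult_left_mono add_mono) auto
      also have "\<dots> = 2 * \<sigma> * (?q / ?d - ?d)" by (simp only: mult_2[symmetric] mult_ac)
      finally show ?thesis .
    next
      case span: False
      have "?d\<^sup>2 \<le> ?q"
      proof (rule ccontr)
        assume "\<not> ?d\<^sup>2 \<le> ?q"
        have "angular_span (x i) (x ` band_neighbours V \<delta> x i) < pi"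
        proof (rule angular_span_less_pi[where w = "z - x i"])
          fix u assume "u \<in> x ` band_neighbours V \<delta> x i"
          then obtain j where u: "u = x j" and j: "?d \<le> norm (x j - x i)"
            by (auto simp: band_neighbours_def norm_minus_commute)
          have "?d\<^sup>2 \<le> (norm (x j - x i))\<^sup>2" using j d by (intro power_mono) auto
          then have "2 * ((x i - z) \<bullet> (x j - x i)) < 0"
            unfolding inner_difference_eq using m[of j] \<open>\<not> ?d\<^sup>2 \<le> ?q\<close> by linarith
          then show "0 < (z - x i) \<bullet> (u - x i)" unfolding u by (simp add: inner_diff_left)
        qed simp
        with span show False by simp
      qed
      then have "0 \<le> ?q / ?d - ?d" using d by (simp add: pos_le_divide_eq power2_eq_square)
      then show ?thesis
        using velocity_obtuse[OF False, of \<sigma>] span \<open>0 < \<sigma>\<close> by simp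
    qed
    \<comment> \<open>The inward term \<open>2 * \<sigma> * ?d\<close> is all that a nonempty band
      guarantees, however large the deficit of \<open>k\<close> is; hence the cap in the
      minimum.\<close>
    also have "2 * \<sigma> * (?q / ?d - ?d) \<le> ?C * ?q - \<sigma> * min (m - ?y k) (2 * ?d)"
    proof -
      have "\<sigma> * min (m - ?y k) (2 * ?d) \<le> \<sigma> * (2 * ?d)" using \<open>0 < \<sigma>\<close> by (intro mult_left_mono) auto
      moreover have "0 \<le> \<sigma> * (real CARD('n) + 1) * ?q" using \<open>0 < \<sigma>\<close> q by simp
      moreover have "?C * ?q = \<sigma> * (real CARD('n) + 1) * ?q + 2 * \<sigma> * (?q / ?d)"
        by (simp add: decay_rate_def distrib_right)
      moreover have "2 * \<sigma> * (?q / ?d - ?d) = 2 * \<sigma> * (?q / ?d) - \<sigma> * (2 * ?d)"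
        by (simp add: right_diff_distrib)
      ultimately show ?thesis by linarith
    qed
    finally show ?thesis .
  qed
qed

section \<open>Deficits along a motion\<close>

lemma norm_square_has_real_derivative:
  fixes f :: "real \<Rightarrow> 'a::real_inner"
  assumes "(f has_vector_derivative f') (at t)"
  shows "((\<lambda>s. (norm (f s - z))\<^sup>2) has_real_derivative 2 * ((f t - z) \<bullet> f')) (at t)"
proof -
  have "((\<lambda>s. f s - z) has_vector_derivative f') (at t)"
    using has_vector_derivative_diff[OF assms has_vector_derivative_const[of z]] by simp
  from bounded_bilinear.has_vector_derivative[OF bounded_bilinear_inner this this]
  have "((\<lambda>s. (f s - z) \<bullet> (f s - z)) has_real_derivative ((f t - z) \<bullet> f' + f' \<bullet> (f t - z))) (at t)"
    unfolding has_real_derivative_iff_has_vector_derivative .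
  moreover have "(f t - z) \<bullet> f' + f' \<bullet> (f t - z) = 2 * ((f t - z) \<bullet> f')"
    by (simp only: inner_commute[of f'] mult_2)
  ultimately show ?thesis by (simp only: power2_norm_eq_inner)
qed

text \<open>Idle steps pad a walk, so walks between different pairs can be given one common
  length.\<close>

lemma relpow_reflcl_mono:
  fixes R :: "('a \<times> 'a) set"
  assumes "m \<le> n" "(i, j) \<in> (R\<^sup>=) ^^ m"
  shows "(i, j) \<in> (R\<^sup>=) ^^ n"
  using assms
proof (induction rule: dec_induct)
  case (step n)
  then show ?case by (intro relpow_Suc_I[of i j]) auto
qed

locale motion =
  fixes p :: "real \<Rightarrow> 'n::finite \<Rightarrow> real^2" and V \<delta> \<sigma> rate :: real
  assumes band: "0 < \<delta>" "\<delta> < V" and gain: "0 < \<sigma>" and moves: "moves_according_to V \<delta> \<sigma> p"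
    and rate: "rate = decay_rate V \<delta> \<sigma> CARD('n)"
begin

abbreviation sq_dist :: "real^2 \<Rightarrow> 'n \<Rightarrow> real \<Rightarrow> real" where
  "sq_dist z i t \<equiv> (norm (p t i - z))\<^sup>2"

lemma rate_pos: "0 < rate"
  using band gain by (simp add: rate decay_rate_def add_pos_pos)

lemma position_abs_continuous:
  assumes "0 \<le> a" "a \<le> b"
  shows "abs_continuous_on a b (\<lambda>t. p t i)"
proof (rule abs_continuous_on_subinterval)
  show "abs_continuous_on 0 b (\<lambda>t. p t i)"
    using moves assms unfolding moves_according_to_def by simp
qed (use assms in simp_all)

lemma sq_dist_abs_continuous:
  assumes "0 \<le> a" "a \<le> b"
  shows "abs_continuous_on a b (sq_dist z i)"
proof (rule abs_continuous_on_norm_square)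
  note ac = position_abs_continuous[OF assms, of i]
  show "abs_continuous_on a b (\<lambda>t. p t i - z)"
    by (rule abs_continuous_on_dominated[OF ac ac, of _ 1]) simp
qed

text \<open>With finitely many agents one null set serves all of them, and at positive times the
  one-sided domain \<open>{0..}\<close> is a neighbourhood.\<close>

lemma obtains_velocity:
  obtains N where "negligible N"
    and "\<And>t i. 0 < t \<Longrightarrow> t \<notin> N \<Longrightarrow> ((\<lambda>s. p s i) has_vector_derivative velocity V \<delta> \<sigma> (p t) i) (at t)"
proof -
  have "AE t in lebesgue. \<forall>i\<in>UNIV. 0 \<le> t \<longrightarrow>
      ((\<lambda>s. p s i) has_vector_derivative velocity V \<delta> \<sigma> (p t) i) (at t within {0..})"
    using moves unfolding moves_according_to_def by (intro AE_finite_allI) auto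
  then obtain N where N: "{t \<in> space lebesgue. \<not> (\<forall>i\<in>UNIV. 0 \<le> t \<longrightarrow>
      ((\<lambda>s. p s i) has_vector_derivative velocity V \<delta> \<sigma> (p t) i) (at t within {0..}))} \<subseteq> N"
    "emeasure lebesgue N = 0" "N \<in> sets lebesgue"
    by (rule AE_E)
  show thesis
  proof
    show "negligible N" using N(2,3) by (simp add: negligible_iff_emeasure0)
    fix t :: real and i assume t: "0 < t" "t \<notin> N"
    from contra_subsetD[OF N(1) t(2)]
    have "((\<lambda>s. p s i) has_vector_derivative velocity V \<delta> \<sigma> (p t) i) (at t within {0..})"
      using t(1) by simp
    moreover have "at t within {0..} = at t" using t(1) by (intro at_within_interior) (simp add: interior_Ici)
    ultimately show "((\<lambda>s. p s i) has_vector_derivative velocity V \<delta> \<sigma> (p t) i) (at t)" by simp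
  qed
qed

text \<open>The squared distance cannot pass the level \<open>c\<close>: strictly between
  \<open>c\<close> and \<open>V\<^sup>2\<close> the two agents are in each other's band and do not
  separate. This is the barrier lemma with strip width \<open>V\<^sup>2 - c\<close>.\<close>

lemma neighbours_persist:
  assumes nb: "j \<in> neighbours V (p 0) i" and "0 \<le> t"
  shows "j \<in> neighbours V (p t) i"
proof -
  have ij: "i \<noteq> j" "norm (p 0 i - p 0 j) < V" using nb by (auto simp: neighbours_def)
  \<comment> \<open>The first argument puts the start at or below the level; the second ensures that
    above it the distance exceeds \<open>V - \<delta>\<close>.\<close>
  define c where "c = max ((norm (p 0 i - p 0 j))\<^sup>2) ((V - \<delta>)\<^sup>2)"
  have c: "c < V\<^sup>2" unfolding c_def using ij band by (simp add: power_strict_mono)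
  obtain N where N: "negligible N"
    and der: "\<And>t i. 0 < t \<Longrightarrow> t \<notin> N \<Longrightarrow> ((\<lambda>s. p s i) has_vector_derivative velocity V \<delta> \<sigma> (p t) i) (at t)"
    using obtains_velocity by blast
  have "- c + 1 * (norm (p t i - p t j))\<^sup>2 \<le> 0"
  proof (rule abs_continuous_barrier[of 0 t _ N "V\<^sup>2 - c"])
    show "abs_continuous_on 0 t (\<lambda>t. - c + 1 * (norm (p t i - p t j))\<^sup>2)"
      using \<open>0 \<le> t\<close> by (intro abs_continuous_on_affine abs_continuous_on_norm_square
          abs_continuous_on_diff position_abs_continuous) auto
    fix s assume s: "s \<in> {0<..<t}" "s \<notin> N"
      and "0 < - c + 1 * (norm (p s i - p s j))\<^sup>2" "- c + 1 * (norm (p s i - p s j))\<^sup>2 < V\<^sup>2 - c"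
    then have sq: "(V - \<delta>)\<^sup>2 < (norm (p s i - p s j))\<^sup>2" "(norm (p s i - p s j))\<^sup>2 < V\<^sup>2"
      unfolding c_def by linarith+
    have "V - \<delta> < norm (p s i - p s j)" "norm (p s i - p s j) < V"
      using power_less_imp_less_base[OF sq(1)] power_less_imp_less_base[OF sq(2)] band by simp_all
    then have "(p s i - p s j) \<bullet> (velocity V \<delta> \<sigma> (p s) i - velocity V \<delta> \<sigma> (p s) j) \<le> 0"
      using band gain ij by (intro band_neighbours_not_separating) auto
    moreover have "((\<lambda>u. p u i - p u j) has_vector_derivative
        (velocity V \<delta> \<sigma> (p s) i - velocity V \<delta> \<sigma> (p s) j)) (at s)"
      using s der by (intro has_vector_derivative_diff) auto
    note DERIV_add[OF DERIV_const[of "- c"] DERIV_cmult[OF norm_square_has_real_derivative[OF this, of 0], of 1]]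
    then have "((\<lambda>u. - c + 1 * (norm (p u i - p u j))\<^sup>2) has_real_derivative
        2 * ((p s i - p s j) \<bullet> (velocity V \<delta> \<sigma> (p s) i - velocity V \<delta> \<sigma> (p s) j))) (at s)"
      by simp
    ultimately show "\<exists>D\<le>0. ((\<lambda>u. - c + 1 * (norm (p u i - p u j))\<^sup>2) has_real_derivative D) (at s)"
      by (intro exI[of _ "2 * ((p s i - p s j) \<bullet> (velocity V \<delta> \<sigma> (p s) i - velocity V \<delta> \<sigma> (p s) j))"])
        simp
  qed (use N c \<open>0 \<le> t\<close> in \<open>simp_all add: c_def\<close>)
  then have "(norm (p t i - p t j))\<^sup>2 < V\<^sup>2" using c by linarith
  then have "norm (p t i - p t j) < V" by (rule power_less_imp_less_base) (use band in simp)
  then show ?thesis using ij by (auto simp: neighbours_def)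
qed

text \<open>A lower barrier for the deficit \<open>m - |p\<^sub>i - z|\<^sup>2\<close>: the slope condition is only needed while the
  deficit is below the line.\<close>

lemma sq_dist_barrier:
  assumes ab: "0 \<le> a" "a \<le> b"
    and m: "\<And>t l. t \<in> {a..b} \<Longrightarrow> sq_dist z l t \<le> m"
    and k: "\<And>t. t \<in> {a..b} \<Longrightarrow> k = i \<or> k \<in> neighbours V (p t) i"
    and start: "\<alpha> \<le> m - sq_dist z i a"
    and slope: "\<And>t. t \<in> {a<..<b} \<Longrightarrow> m - sq_dist z i t < \<alpha> + \<beta> * (t - a) \<Longrightarrow>
      \<beta> \<le> \<sigma> * min (m - sq_dist z k t) (2 * (V - \<delta>)) - rate * (m - sq_dist z i t)"
  shows "\<alpha> + \<beta> * (b - a) \<le> m - sq_dist z i b"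
proof -
  obtain N where N: "negligible N"
    and der: "\<And>t i. 0 < t \<Longrightarrow> t \<notin> N \<Longrightarrow> ((\<lambda>s. p s i) has_vector_derivative velocity V \<delta> \<sigma> (p t) i) (at t)"
    using obtains_velocity by blast
  \<comment> \<open>The line minus the deficit, written in the shape of the rules for differences
    and affine images.\<close>
  let ?g = "\<lambda>t. ((\<alpha> - \<beta> * a - m) + \<beta> * t) - (0 + (-1) * sq_dist z i t)"
  have "?g b \<le> 0"
  \<comment> \<open>The width 1 is arbitrary, since the slope is controlled wherever
    \<open>?g\<close> is positive.\<close>
  proof (rule abs_continuous_barrier[of a b _ N 1])
    show "abs_continuous_on a b ?g"
      by (intro abs_continuous_on_diff abs_continuous_on_affine abs_continuous_on_ident
          sq_dist_abs_continuous ab)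
    fix t assume t: "t \<in> {a<..<b}" "t \<notin> N" and "0 < ?g t"
    then have "\<beta> \<le> \<sigma> * min (m - sq_dist z k t) (2 * (V - \<delta>)) - rate * (m - sq_dist z i t)"
      by (intro slope) (auto simp: algebra_simps)
    moreover have "2 * ((p t i - z) \<bullet> velocity V \<delta> \<sigma> (p t) i) \<le>
        rate * (m - sq_dist z i t) - \<sigma> * min (m - sq_dist z k t) (2 * (V - \<delta>))"
      unfolding rate using t band gain m k by (intro velocity_inner_le) auto
    ultimately have "\<beta> + 2 * ((p t i - z) \<bullet> velocity V \<delta> \<sigma> (p t) i) \<le> 0" by linarith
    moreover have "((\<lambda>t. (\<alpha> - \<beta> * a - m) + \<beta> * t) has_real_derivative \<beta>) (at t)"
      by (auto intro!: derivative_eq_intros)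
    moreover have "(sq_dist z i has_real_derivative 2 * ((p t i - z) \<bullet> velocity V \<delta> \<sigma> (p t) i)) (at t)"
      using t ab der by (intro norm_square_has_real_derivative) auto
    note DERIV_diff[OF calculation(2) DERIV_add[OF DERIV_const[of 0] DERIV_cmult[OF this, of "- 1"]]]
    then have "(?g has_real_derivative \<beta> + 2 * ((p t i - z) \<bullet> velocity V \<delta> \<sigma> (p t) i)) (at t)"
      by simp
    ultimately show "\<exists>D\<le>0. (?g has_real_derivative D) (at t)" by blast
  qed (use N ab start in \<open>auto simp: algebra_simps\<close>)
  then show ?thesis by (simp add: algebra_simps)
qed

section \<open>Decay and spread of deficits\<close>

text \<open>A line of slope \<open>- (rate * A)\<close> replaces the exponential: below it the
  deficit is at most \<open>A\<close>, so it is lost no faster than \<open>rate * A\<close>, and the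
  given duration costs at most \<open>A / 2\<close>. The choice \<open>k = i\<close> avoids any
  reference to neighbours.\<close>

lemma deficit_decay:
  assumes "0 \<le> a" "a \<le> b" and m: "\<And>t l. t \<in> {a..b} \<Longrightarrow> sq_dist z l t \<le> m"
    and A: "0 \<le> A" "A \<le> m - sq_dist z i a" and "2 * rate * (b - a) \<le> 1"
  shows "A / 2 \<le> m - sq_dist z i b"
proof -
  have "A + (- (rate * A)) * (b - a) \<le> m - sq_dist z i b"
  proof (rule sq_dist_barrier[where k = i and a = a and b = b and \<alpha> = A and \<beta> = "- (rate * A)"
        and m = m and z = z and i = i])
    fix t assume t: "t \<in> {a<..<b}" and "m - sq_dist z i t < A + (- (rate * A)) * (t - a)"
    moreover have "0 \<le> (rate * A) * (t - a)" using t A rate_pos by (intro mult_nonneg_nonneg) auto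
    ultimately have "m - sq_dist z i t \<le> A" unfolding mult_minus_left by linarith
    then have "rate * (m - sq_dist z i t) \<le> rate * A" using rate_pos by (intro mult_left_mono) auto
    moreover have "0 \<le> \<sigma> * min (m - sq_dist z i t) (2 * (V - \<delta>))"
      using m[of t i] t gain band by (intro mult_nonneg_nonneg) auto
    ultimately show "- (rate * A) \<le> \<sigma> * min (m - sq_dist z i t) (2 * (V - \<delta>)) - rate * (m - sq_dist z i t)"
      by linarith
  next
    show "sq_dist z l t \<le> m" if "t \<in> {a..b}" for t l using m[OF that] .
  qed (use assms(1,2) A(2) in simp_all)
  moreover have "A * (2 * rate * (b - a)) \<le> A * 1"
    using A(1) assms(6) by (rule mult_left_mono[rotated])
  then have "- (rate * A) * (b - a) \<ge> - (A / 2)" by (simp add: algebra_simps)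
  ultimately show ?thesis by linarith
qed

lemma sq_dist_bound_short:
  assumes a: "0 \<le> a" "2 * rate * (b - a) \<le> 1" and m: "\<And>l. sq_dist z l a \<le> m" and t: "t \<in> {a..b}"
  shows "sq_dist z i t \<le> m"
proof -
  have "\<exists>s\<in>{a..b}. \<forall>u\<in>{a..b}. sq_dist z l u \<le> sq_dist z l s" for l
    using a t by (intro continuous_attains_sup abs_continuous_on_imp_continuous_on sq_dist_abs_continuous) auto
  then obtain s where s: "\<And>l. s l \<in> {a..b}" "\<And>l u. u \<in> {a..b} \<Longrightarrow> sq_dist z l u \<le> sq_dist z l (s l)"
    by metis
  txt \<open>The maximum \<open>M\<close> over the whole time interval bounds all agents, so the deficit to \<open>M\<close> of the
    agent that attains it cannot have dropped from \<open>M - m\<close> to \<open>0\<close>.\<close>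
  define M where "M = Max (range (\<lambda>l. sq_dist z l (s l)))"
  have "M \<in> range (\<lambda>l. sq_dist z l (s l))" unfolding M_def by (intro Max_in) auto
  then obtain j where j: "M = sq_dist z j (s j)" by blast
  have le: "sq_dist z l (s l) \<le> M" for l unfolding M_def by (intro Max_ge) auto
  have M: "sq_dist z l u \<le> M" if "u \<in> {a..b}" for u l using s(2)[OF that, of l] le[of l] by linarith
  have "(M - m) / 2 \<le> M - sq_dist z j (s j)" if "m \<le> M"
  proof (rule deficit_decay)
    have "2 * rate * (s j - a) \<le> 2 * rate * (b - a)"
      using s(1)[of j] rate_pos by (intro mult_left_mono) auto
    then show "2 * rate * (s j - a) \<le> 1" using a by linarith
  qed (use that s(1)[of j] a(1) M m[of j] in simp_all)
  then have "M \<le> m" using j by (cases "m \<le> M") auto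
  then show ?thesis using M[OF t, of i] by linarith
qed

text \<open>The longest duration that \<open>deficit_decay\<close> admits.\<close>

definition step :: real where
  "step = 1 / (2 * rate)"

lemma step_pos: "0 < step"
  using rate_pos by (simp add: step_def)

text \<open>The bound at the end of one time step is the hypothesis for the next, and finitely many
  steps reach any time.\<close>

lemma sq_dist_bound:
  assumes "0 \<le> a" "a \<le> t" and m: "\<And>l. sq_dist z l a \<le> m"
  shows "sq_dist z i t \<le> m"
proof -
  have *: "\<forall>i. \<forall>t\<in>{a..a + real k * step}. sq_dist z i t \<le> m" for k
  proof (induction k)
    case 0
    then show ?case using m by auto
  next
    case (Suc k)
    show ?case
    proof (intro allI ballI)
      fix i t assume t: "t \<in> {a..a + real (Suc k) * step}"
      show "sq_dist z i t \<le> m"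
      proof (cases "t \<le> a + real k * step")
        case False
        show ?thesis
        proof (rule sq_dist_bound_short[of "a + real k * step" "a + real k * step + step"])
          show "sq_dist z l (a + real k * step) \<le> m" for l using Suc step_pos by auto
          show "t \<in> {a + real k * step..a + real k * step + step}"
            using t False by (auto simp: algebra_simps)
          show "2 * rate * (a + real k * step + step - (a + real k * step)) \<le> 1"
            using rate_pos by (simp add: step_def)
        qed (use assms(1) step_pos in auto)
      qed (use Suc t in auto)
    qed
  qed
  obtain k where "(t - a) / step < real k" using reals_Archimedean2 by blast
  then have "t - a < real k * step" using step_pos by (simp add: pos_divide_less_eq)
  then show ?thesis using *[of k] assms(2) by auto
qed

text \<open>During one step a neighbour's deficit stays at least \<open>A / 2\<close>, which feeds
  the agent at rate \<open>\<sigma> * min (A / 2) (2 * (V - \<delta>))\<close>. Half of that rate is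
  kept as the guaranteed net growth.\<close>

definition gain_step :: "real \<Rightarrow> real" where
  "gain_step A = \<sigma> * step / 2 * min (A / 2) (2 * (V - \<delta>))"

lemma gain_step_pos: "0 < A \<Longrightarrow> 0 < gain_step A"
  using step_pos gain band by (simp add: gain_step_def)

text \<open>The barrier is a line of slope \<open>s / 2\<close>. Below it the agent's own deficit is
  less than \<open>s / 2 * step\<close>, so decay costs at most \<open>s / 4\<close>, while agent
  \<open>k\<close> supplies at least \<open>s\<close>. The case \<open>k = i\<close> accounts for
  idle steps of a walk.\<close>

lemma deficit_spreads:
  assumes "0 \<le> a" and m: "\<And>l. sq_dist z l a \<le> m"
    and k: "k = i \<or> i \<in> neighbours V (p 0) k" and A: "0 < A" "A \<le> m - sq_dist z k a"
  shows "gain_step A \<le> m - sq_dist z i (a + step)"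
proof -
  have bound: "sq_dist z l t \<le> m" if "a \<le> t" for l t
    using sq_dist_bound[OF assms(1) that m] .
  define s where "s = \<sigma> * min (A / 2) (2 * (V - \<delta>))"
  have s: "0 < s" using A gain band by (simp add: s_def)
  have C: "rate * step = 1 / 2" using rate_pos by (simp add: step_def)
  have "0 + s / 2 * (a + step - a) \<le> m - sq_dist z i (a + step)"
  proof (rule sq_dist_barrier[where k = k and a = a and b = "a + step" and \<alpha> = 0 and \<beta> = "s / 2"
        and m = m and z = z and i = i])
    fix t assume t: "t \<in> {a..a + step}"
    then have "k \<in> neighbours V (p 0) i \<Longrightarrow> k \<in> neighbours V (p t) i"
      using assms(1) neighbours_persist[of k i t] by simp
    moreover have "i \<in> neighbours V (p 0) k \<Longrightarrow> k \<in> neighbours V (p 0) i"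
      by (auto simp: neighbours_def norm_minus_commute)
    ultimately show "k = i \<or> k \<in> neighbours V (p t) i" using k by blast
  next
    fix t assume t: "t \<in> {a<..<a + step}" and lt: "m - sq_dist z i t < 0 + s / 2 * (t - a)"
    have "s / 2 * (t - a) \<le> s / 2 * step" using t s by (intro mult_left_mono) auto
    with lt have "rate * (m - sq_dist z i t) \<le> rate * (s / 2 * step)"
      using rate_pos by (intro mult_left_mono) auto
    also have "\<dots> = s / 2 * (rate * step)" by (simp only: mult_ac)
    also have "\<dots> = s / 4" unfolding C by simp
    finally have "rate * (m - sq_dist z i t) \<le> s / 4" .
    moreover have "A / 2 \<le> m - sq_dist z k t"
    proof (rule deficit_decay[OF assms(1)])
      have "2 * rate * (t - a) \<le> 2 * rate * step" using t rate_pos by (intro mult_left_mono) auto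
      then show "2 * rate * (t - a) \<le> 1" using C by simp
    qed (use t bound A in simp_all)
    then have "s \<le> \<sigma> * min (m - sq_dist z k t) (2 * (V - \<delta>))"
      unfolding s_def using gain by (intro mult_left_mono) auto
    ultimately show "s / 2 \<le> \<sigma> * min (m - sq_dist z k t) (2 * (V - \<delta>)) - rate * (m - sq_dist z i t)"
      using s by linarith
  qed (use assms(1) bound m[of i] step_pos in simp_all)
  then show ?thesis by (simp add: gain_step_def s_def mult_ac)
qed

text \<open>One edge of the walk is used per time step. The level \<open>m\<close> fixed at time
  \<open>a\<close> remains a bound throughout by \<open>sq_dist_bound\<close>, so all deficits refer
  to the same level.\<close>

lemma deficit_spreads_relpow:
  assumes "0 \<le> a" and m: "\<And>l. sq_dist z l a \<le> m" and A: "0 < A" "A \<le> m - sq_dist z i a"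
    and "(i, j) \<in> ({(k, l). l \<in> neighbours V (p 0) k}\<^sup>=) ^^ n"
  shows "0 < (gain_step ^^ n) A \<and> (gain_step ^^ n) A \<le> m - sq_dist z j (a + real n * step)"
  using assms(5)
proof (induction n arbitrary: j)
  case 0
  then show ?case using A by simp
next
  case (Suc n)
  then obtain k where k: "(i, k) \<in> ({(k, l). l \<in> neighbours V (p 0) k}\<^sup>=) ^^ n" "k = j \<or> j \<in> neighbours V (p 0) k"
    by auto
  have "gain_step ((gain_step ^^ n) A) \<le> m - sq_dist z j (a + real n * step + step)"
    using Suc.IH[OF k(1)] k(2) assms(1) step_pos sq_dist_bound[OF assms(1) _ m]
    by (intro deficit_spreads) auto
  then show ?case using Suc.IH[OF k(1)] gain_step_pos by (simp add: algebra_simps)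
qed

section \<open>Convergence of the squared distances and of the positions\<close>

lemma sq_dist_tendsto:
  assumes conn: "neighbourhood_graph_connected V (p 0)"
  shows "\<exists>h. \<forall>i. (sq_dist z i \<longlongrightarrow> h) at_top"
proof -
  let ?R = "{(k, l). l \<in> neighbours V (p 0) k}"
  \<comment> \<open>A common walk length makes the deficit of one agent reach all agents at the same
    time.\<close>
  have "(i, j) \<in> (?R\<^sup>=) ^^ card (?R\<^sup>=)" for i j
  proof -
    have "(i, j) \<in> (?R\<^sup>=)\<^sup>*" using conn unfolding neighbourhood_graph_connected_def by simp
    then obtain k where "k \<le> card (?R\<^sup>=)" "(i, j) \<in> (?R\<^sup>=) ^^ k"
      unfolding rtrancl_finite_eq_relpow[OF finite] by blast
    then show ?thesis by (rule relpow_reflcl_mono)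
  qed
  then obtain n where n: "\<And>i j. (i, j) \<in> (?R\<^sup>=) ^^ n"
    by blast
  \<comment> \<open>The levels that bound all agents at some time; their infimum is that of the
    maximal squared distance.\<close>
  define H where "H = {m. \<exists>a\<ge>0. \<forall>i. sq_dist z i a \<le> m}"
  define h where "h = Inf H"
  have "Max (range (\<lambda>i. sq_dist z i 0)) \<in> H" unfolding H_def by auto
  then have "H \<noteq> {}" by blast
  have "0 \<le> m" if "m \<in> H" for m using that unfolding H_def by (auto intro: order_trans[OF zero_le_power2])
  then have "bdd_below H" by (intro bdd_belowI[of H 0])
  have "(sq_dist z i \<longlongrightarrow> h) at_top" for i
  proof (rule order_tendstoI)
    fix m assume "h < m"
    then obtain m' where "m' \<in> H" "m' < m" using \<open>H \<noteq> {}\<close> cInf_lessD unfolding h_def by blast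
    then obtain a where a: "0 \<le> a" "\<And>i. sq_dist z i a \<le> m'" unfolding H_def by blast
    have "sq_dist z i t < m" if "a \<le> t" for t
      using sq_dist_bound[OF a(1) that a(2)] \<open>m' < m\<close> by (rule le_less_trans)
    then show "\<forall>\<^sub>F t in at_top. sq_dist z i t < m" using eventually_at_top_linorder by blast
  next
    fix l assume "l < h"
    \<comment> \<open>This gain depends on \<open>h - l\<close> and \<open>n\<close> only, so the
      level \<open>m\<close> and the time \<open>a\<close> can be chosen afterwards with
      \<open>m\<close> within \<open>b\<close> of \<open>h\<close>.\<close>
    define b where "b = (gain_step ^^ n) (h - l)"
    have b: "0 < b"
      unfolding b_def by (induction n) (use \<open>l < h\<close> gain_step_pos in auto)
    then obtain m where m: "m \<in> H" "m < h + b"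
      using \<open>H \<noteq> {}\<close> cInf_lessD[of H "h + b"] unfolding h_def by auto
    then obtain a where a: "0 \<le> a" "\<And>i. sq_dist z i a \<le> m" unfolding H_def by blast
    have "h \<le> m" unfolding h_def using m(1) \<open>bdd_below H\<close> by (rule cInf_lower)
    have "l < sq_dist z i t" if t: "a \<le> t" for t
    proof (rule ccontr)
      assume "\<not> l < sq_dist z i t"
      \<comment> \<open>An agent at squared distance at most \<open>l\<close> has deficit at least
        \<open>m - l\<close>, hence at least \<open>h - l\<close>. After \<open>n\<close> steps
        every deficit is at least \<open>b\<close>, which puts \<open>m - b\<close> into
        \<open>H\<close> although it is below \<open>h\<close>.\<close>
      then have "b \<le> m - sq_dist z j (t + real n * step)" for j
        using deficit_spreads_relpow[of t z m "h - l" i j n] n t a \<open>h \<le> m\<close> \<open>l < h\<close>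
          sq_dist_bound[OF a(1) t a(2)] unfolding b_def by auto
      then have "sq_dist z j (t + real n * step) \<le> m - b" for j by (simp add: algebra_simps)
      then have "m - b \<in> H" unfolding H_def using a(1) t step_pos
        by (auto intro!: exI[of _ "t + real n * step"] add_nonneg_nonneg)
      then have "h \<le> m - b" unfolding h_def using \<open>bdd_below H\<close> by (rule cInf_lower)
      then show False using m(2) by linarith
    qed
    then show "\<forall>\<^sub>F t in at_top. l < sq_dist z i t" using eventually_at_top_linorder by blast
  qed
  then show ?thesis by blast
qed

end

theorem theorem6:
  fixes p :: "real \<Rightarrow> 'n::finite \<Rightarrow> real^2"
    and V \<delta> \<sigma> :: real
  assumes "0 < \<delta>" and "\<delta> < V" and "0 < \<sigma>"
    and "moves_according_to V \<delta> \<sigma> p"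
    and "neighbourhood_graph_connected V (p 0)"
  shows "\<exists>q. \<forall>i. ((\<lambda>t. p t i) \<longlongrightarrow> q) at_top"
proof -
  interpret motion p V \<delta> \<sigma> "decay_rate V \<delta> \<sigma> CARD('n)"
    by unfold_locales (fact assms refl)+
  obtain h where h: "\<And>z i. (sq_dist z i \<longlongrightarrow> h z) at_top"
    using sq_dist_tendsto[OF assms(5)] by metis
  \<comment> \<open>Polarisation: for a unit vector \<open>e\<close>, the squared norms of
    \<open>p\<close> and \<open>p - e\<close> differ by twice the component of \<open>p\<close>
    along \<open>e\<close>, minus 1.\<close>
  define q where "q = (\<chi> c. (h 0 - h (axis c 1) + 1) / 2)"
  have "((\<lambda>t. p t i) \<longlongrightarrow> q) at_top" for i
  proof (rule vec_tendstoI)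
    fix c
    have "(\<lambda>t. p t i $ c) = (\<lambda>t. (sq_dist 0 i t - sq_dist (axis c 1) i t + 1) / 2)"
      by (rule ext) (simp add: power2_norm_eq_inner inner_diff_left inner_diff_right inner_axis inner_commute[of "axis c 1"] inner_axis_axis)
    moreover have "((\<lambda>t. (sq_dist 0 i t - sq_dist (axis c 1) i t + 1) / 2) \<longlongrightarrow> q $ c) at_top"
      unfolding q_def vec_lambda_beta by (intro tendsto_intros h) simp
    ultimately show "((\<lambda>t. p t i $ c) \<longlongrightarrow> q $ c) at_top" by (simp only:)
  qed
  then show ?thesis by blast
qed

end
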